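(* Let $\lambda,\mu\in\mathbb{R}$ and let $f(z)=z+\lambda$ and $g(z)=z/(\mu z+1)$. The semigroup generated by $f$ and $g$ is semidiscrete and inverse free if and only if $\lambda\mu\notin(-4,0]$.
   Context: The group $\mathcal{M}\cong\mathrm{PSL}(2,\mathbb{R})$ of real Möbius transformations $z\mapsto (az+b)/(cz+d)$ ($a,b,c,d\in\mathbb{R}$, $ad-bc>0$) is a topological group with identity $I$. The semigroup generated by $f$ and $g$ is the set of all finite compositions (of one or more factors) of copies of $f$ and $g$. A semigroup $S\subset\mathcal{M}$ is semidiscrete if $I$ is not an accumulation point of $S$ in $\mathcal{M}$, and inverse free if $I\notin S$. *)

theory Defs
  imports "HOL-Analysis.Analysis"
begin

text \<open>
  Moebius transformations are maps of the extended complex plane, encoded as \<^typ>\<open>complex option\<close>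
  with \<^term>\<open>None\<close> for the point at infinity. In this way composition of transformations is
  composition of functions, and \<^term>\<open>id\<close> is the identity transformation.
\<close>

definition real_moebius :: "real \<Rightarrow> real \<Rightarrow> real \<Rightarrow> real \<Rightarrow> complex option \<Rightarrow> complex option" where
  "real_moebius a b c d w =
     (case w of
        None \<Rightarrow> if c = 0 then None else Some (complex_of_real a / complex_of_real c)
      | Some z \<Rightarrow>
          if complex_of_real c * z + complex_of_real d = 0 then None
          else Some (moebius (of_real a) (of_real b) (of_real c) (of_real d) z))"

definition moebius_group :: "(complex option \<Rightarrow> complex option) set" where
  "moebius_group = {real_moebius a b c d | a b c d. a * d - b * c > 0}"

text \<open>
  The topology of \<open>PSL(2,\<real>)\<close>: the quotient topology of the space of coefficients
  \<open>(a, b, c, d)\<close> with \<open>a d - b c > 0\<close>, an open subset of \<open>\<real>\<^sup>4\<close>.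
\<close>

definition moebius_topology :: "(complex option \<Rightarrow> complex option) topology" where
  "moebius_topology = topology (\<lambda>U. U \<subseteq> moebius_group \<and>
     open {(a, b, c, d). a * d - b * c > 0 \<and> real_moebius a b c d \<in> U})"

definition generated_semigroup :: "('a \<Rightarrow> 'a) set \<Rightarrow> ('a \<Rightarrow> 'a) set" where
  "generated_semigroup X = {foldr (\<circ>) hs id | hs. hs \<noteq> [] \<and> set hs \<subseteq> X}"

definition semidiscrete :: "(complex option \<Rightarrow> complex option) set \<Rightarrow> bool" where
  "semidiscrete S \<longleftrightarrow> id \<notin> moebius_topology derived_set_of S"

definition inverse_free :: "('a \<Rightarrow> 'a) set \<Rightarrow> bool" where
  "inverse_free S \<longleftrightarrow> id \<notin> S"

lemma moebius_translation:
  "real_moebius 1 l 0 1 (Some z) = Some (z + complex_of_real l)"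
  "real_moebius 1 l 0 1 None = None"
  by (simp_all add: real_moebius_def moebius_def)

lemma moebius_lower_triangular:
  "complex_of_real m * z + 1 \<noteq> 0 \<Longrightarrow>
     real_moebius 1 0 m 1 (Some z) = Some (z / (complex_of_real m * z + 1))"
  by (simp add: real_moebius_def moebius_def)

lemma moebius_id: "real_moebius 1 0 0 1 = id"
  by (auto simp: real_moebius_def moebius_def fun_eq_iff split: option.split)

lemma moebius_comp:
  assumes "a * d - b * c > 0" "a' * d' - b' * c' > 0"
  shows "real_moebius a b c d \<circ> real_moebius a' b' c' d' =
    real_moebius (a * a' + b * c') (a * b' + b * d') (c * a' + d * c') (c * b' + d * d')"
proof
  fix w
  define p where
    "p = (case w of None \<Rightarrow> complex_of_real a' | Some z \<Rightarrow> complex_of_real a' * z + of_real b')"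
  define q where
    "q = (case w of None \<Rightarrow> complex_of_real c' | Some z \<Rightarrow> complex_of_real c' * z + of_real d')"
  have p: "p \<noteq> 0" if "q = 0"
  proof (cases w)
    case None
    then show ?thesis using assms(2) that by (auto simp: p_def q_def)
  next
    case (Some z)
    show ?thesis
    proof
      assume "p = 0"
      have "of_real a' * q - of_real c' * p = of_real (a' * d' - b' * c')"
        by (simp add: p_def q_def Some algebra_simps)
      then have "complex_of_real (a' * d' - b' * c') = 0" using \<open>p = 0\<close> that by simp
      then show False using assms(2) by (simp only: of_real_eq_0_iff)
    qed
  qed
  have *: "complex_of_real c * (p / q) + of_real d = (of_real c * p + of_real d * q) / q"
    "complex_of_real a * (p / q) + of_real b = (of_real a * p + of_real b * q) / q"
    if "q \<noteq> 0" using that by (simp_all add: field_simps)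
  have inner: "real_moebius a' b' c' d' w = (if q = 0 then None else Some (p / q))"
    by (cases w) (simp_all add: real_moebius_def moebius_def p_def q_def)
  have outer: "real_moebius (a * a' + b * c') (a * b' + b * d') (c * a' + d * c') (c * b' + d * d') w
    = (if of_real c * p + of_real d * q = 0 then None
       else Some ((of_real a * p + of_real b * q) / (of_real c * p + of_real d * q)))"
  proof (cases w)
    case None
    have "complex_of_real c * of_real a' + of_real d * of_real c' = 0
        \<longleftrightarrow> c * a' + d * c' = 0"
      by (metis of_real_add of_real_mult of_real_eq_0_iff)
    then show ?thesis using None by (simp add: real_moebius_def moebius_def p_def q_def)
  next
    case (Some z)
    have num: "complex_of_real (a * a' + b * c') * z + of_real (a * b' + b * d')
        = of_real a * p + of_real b * q"
      and den: "complex_of_real (c * a' + d * c') * z + of_real (c * b' + d * d')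
        = of_real c * p + of_real d * q"
      by (simp_all add: p_def q_def Some algebra_simps)
    show ?thesis using Some unfolding real_moebius_def moebius_def by (simp only: option.case num den)
  qed
  show "(real_moebius a b c d \<circ> real_moebius a' b' c' d') w =
    real_moebius (a * a' + b * c') (a * b' + b * d') (c * a' + d * c') (c * b' + d * d') w"
    unfolding comp_apply inner outer
    by (cases "q = 0") (use p * in \<open>simp_all add: real_moebius_def moebius_def\<close>)
qed

lemma moebius_group_comp:
  assumes "s \<in> moebius_group" "t \<in> moebius_group"
  shows "s \<circ> t \<in> moebius_group"
proof -
  obtain a b c d where s: "s = real_moebius a b c d" "a * d - b * c > 0"
    using assms(1) by (auto simp: moebius_group_def)
  obtain a' b' c' d' where t: "t = real_moebius a' b' c' d'" "a' * d' - b' * c' > 0"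
    using assms(2) by (auto simp: moebius_group_def)
  have "(a * a' + b * c') * (c * b' + d * d') - (a * b' + b * d') * (c * a' + d * c')
      = (a * d - b * c) * (a' * d' - b' * c')"
    by (simp add: algebra_simps)
  also have "\<dots> > 0" using s(2) t(2) by simp
  finally show ?thesis
    unfolding s(1) t(1) moebius_comp[OF s(2) t(2)] moebius_group_def by blast
qed

lemma open_coefficients: "open {(a, b, c, d). a * d - b * c > (0::real)}"
  unfolding case_prod_unfold by (intro open_Collect_less continuous_intros)

lemma openin_moebius_topology:
  "openin moebius_topology U \<longleftrightarrow> U \<subseteq> moebius_group \<and>
     open {(a, b, c, d). a * d - b * c > 0 \<and> real_moebius a b c d \<in> U}"
proof -
  let ?P = "\<lambda>U. {(a, b, c, d). a * d - b * c > 0 \<and> real_moebius a b c d \<in> U}"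
  have "istopology (\<lambda>U. U \<subseteq> moebius_group \<and> open (?P U))"
    unfolding istopology_def
  proof (intro conjI allI impI)
    fix S T assume "S \<subseteq> moebius_group \<and> open (?P S)" "T \<subseteq> moebius_group \<and> open (?P T)"
    moreover have "?P (S \<inter> T) = ?P S \<inter> ?P T" by auto
    ultimately show "S \<inter> T \<subseteq> moebius_group" "open (?P (S \<inter> T))"
      by (auto simp only: open_Int)
  next
    fix K assume K: "\<forall>S\<in>K. S \<subseteq> moebius_group \<and> open (?P S)"
    then show "\<Union>K \<subseteq> moebius_group" by blast
    have "?P (\<Union>K) = (\<Union>S\<in>K. ?P S)" by auto
    then show "open (?P (\<Union>K))" using K by (simp only:) blast
  qed
  then show ?thesis by (simp add: moebius_topology_def topology_inverse')
qed

lemma topspace_moebius_topology: "topspace moebius_topology = moebius_group"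
proof -
  have "{(a, b, c, d). a * d - b * c > 0 \<and> real_moebius a b c d \<in> moebius_group}
      = {(a, b, c, d). a * d - b * c > 0}"
    by (auto simp: moebius_group_def)
  then have "openin moebius_topology moebius_group"
    using open_coefficients by (simp only: openin_moebius_topology) simp
  then show ?thesis
    by (metis openin_moebius_topology openin_subset openin_topspace subset_antisym)
qed

lemma quotient_map_moebius:
  "quotient_map (top_of_set {(a, b, c, d). a * d - b * c > 0}) moebius_topology
     (\<lambda>(a, b, c, d). real_moebius a b c d)"
  unfolding quotient_map_def
proof (intro conjI allI impI)
  show "(\<lambda>(a, b, c, d). real_moebius a b c d) `
      topspace (top_of_set {(a, b, c, d). a * d - b * c > 0}) = topspace moebius_topology"
    by (force simp: topspace_moebius_topology moebius_group_def)
next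
  fix U assume U: "U \<subseteq> topspace moebius_topology"
  have "{x \<in> topspace (top_of_set {(a, b, c, d). a * d - b * c > 0}).
        (case x of (a, b, c, d) \<Rightarrow> real_moebius a b c d) \<in> U}
      = {(a, b, c, d). a * d - b * c > 0 \<and> real_moebius a b c d \<in> U}"
    by auto
  moreover have "{(a, b, c, d). a * d - b * c > 0 \<and> real_moebius a b c d \<in> U}
      \<subseteq> {(a, b, c, d). a * d - b * c > 0}"
    by auto
  ultimately show "openin (top_of_set {(a, b, c, d). a * d - b * c > 0})
      {x \<in> topspace (top_of_set {(a, b, c, d). a * d - b * c > 0}).
        (case x of (a, b, c, d) \<Rightarrow> real_moebius a b c d) \<in> U} = openin moebius_topology U"
    using U open_coefficients
    by (simp add: openin_open_eq openin_moebius_topology topspace_moebius_topology)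
qed

end

theory Submission
  imports Defs
begin

text \<open>
  If \<open>\<lambda>\<mu> = 0\<close>, a generator is the identity. If \<open>-4 < \<lambda>\<mu> < 0\<close>, then \<open>f \<circ> g\<close> has trace
  \<open>2 + \<lambda>\<mu>\<close> strictly between \<open>-2\<close> and \<open>2\<close>, so it is elliptic and Dirichlet approximation of its
  rotation angle gives powers arbitrarily close to the identity. In the remaining cases a ping-pong
  argument on the columns of the matrix of a word (with separate treatment of \<open>\<lambda>\<mu> > 0\<close>, where
  nothing cancels) shows that one of its two off-diagonal entries is bounded away from \<open>0\<close>.
\<close>

section \<open>Coefficients are determined up to a common factor\<close>

text \<open>Three values suffice: fixing \<infinity> forces \<open>c = 0\<close>, fixing 0 then
  forces \<open>b = 0\<close>, and fixing 1 forces \<open>a = d\<close>.\<close>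

lemma real_moebius_eq_id:
  assumes "real_moebius a b c d = id" "a * d - b * c > 0"
  shows "b = 0" "c = 0" "a = d"
proof -
  have "real_moebius a b c d None = None" using assms(1) by simp
  then show c: "c = 0" by (auto simp: real_moebius_def split: if_splits)
  then have d: "d \<noteq> 0" using assms(2) by auto
  have "real_moebius a b c d (Some 0) = Some 0" using assms(1) by simp
  then show b: "b = 0" using c d by (auto simp: real_moebius_def moebius_def)
  have "real_moebius a b c d (Some 1) = Some 1" using assms(1) by simp
  then show "a = d" using b c d by (auto simp: real_moebius_def moebius_def)
qed

lemma real_moebius_scalar: "k \<noteq> 0 \<Longrightarrow> real_moebius k 0 0 k = id"
  by (auto simp: real_moebius_def moebius_def fun_eq_iff split: option.split)

text \<open>Multiply the second matrix on the left by the adjugate of the first. The product induces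
  the identity, hence is a scalar matrix \<open>p\<close>; multiplying back by the first matrix,
  whose determinant is \<open>D\<close>, gives \<open>k = p / D\<close>.\<close>

lemma real_moebius_eq_imp_proportional:
  assumes eq: "real_moebius a b c d = real_moebius a' b' c' d'"
    and det: "a * d - b * c > 0" "a' * d' - b' * c' > 0"
  obtains k where "k \<noteq> 0" "a' = k * a" "b' = k * b" "c' = k * c" "d' = k * d"
proof -
  define D where "D = a * d - b * c"
  define p q r s where "p = d * a' - b * c'" and "q = d * b' - b * d'"
    and "r = a * c' - c * a'" and "s = a * d' - c * b'"
  have adj: "d * a - (- b) * (- c) > 0" using det(1) by (simp add: algebra_simps)
  have "real_moebius p q r s = real_moebius d (- b) (- c) a \<circ> real_moebius a' b' c' d'"
    unfolding moebius_comp[OF adj det(2)] by (simp add: p_def q_def r_def s_def)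
  also have "\<dots> = real_moebius D 0 0 D"
    unfolding eq[symmetric] moebius_comp[OF adj det(1)] by (simp add: D_def algebra_simps)
  also have "\<dots> = id" using det(1) by (simp add: real_moebius_scalar D_def)
  finally have id: "real_moebius p q r s = id" .
  have "p * s - q * r = D * (a' * d' - b' * c')"
    by (simp add: p_def q_def r_def s_def D_def algebra_simps)
  also have "\<dots> > 0" using det by (simp add: D_def)
  finally have pos: "p * s - q * r > 0" .
  note z = real_moebius_eq_id[OF id pos]
  have "D * a' = a * p + b * r" "D * b' = a * q + b * s" "D * c' = c * p + d * r"
    "D * d' = c * q + d * s"
    by (simp_all add: p_def q_def r_def s_def D_def algebra_simps)
  moreover have "D \<noteq> 0" "p \<noteq> 0" using det(1) pos z by (auto simp: D_def)
  ultimately show thesis using z by (intro that[of "p / D"]) (auto simp: field_simps)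
qed

section \<open>A neighbourhood of the identity\<close>

text \<open>Both inequalities are homogeneous of degree two in the coefficients, so they do not
  depend on the matrix that represents the transformation.\<close>

definition small_off_diagonal :: "real \<Rightarrow> (complex option \<Rightarrow> complex option) set" where
  "small_off_diagonal e = {real_moebius a b c d | a b c d. a * d - b * c > 0 \<and>
     b\<^sup>2 < e * (a * d - b * c) \<and> c\<^sup>2 < e * (a * d - b * c)}"

lemma real_moebius_in_small_off_diagonal:
  assumes det: "a * d - b * c > 0"
  shows "real_moebius a b c d \<in> small_off_diagonal e \<longleftrightarrow>
    b\<^sup>2 < e * (a * d - b * c) \<and> c\<^sup>2 < e * (a * d - b * c)"
proof
  assume "real_moebius a b c d \<in> small_off_diagonal e"
  then obtain a' b' c' d' where *: "real_moebius a b c d = real_moebius a' b' c' d'"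
    "a' * d' - b' * c' > 0" "b'\<^sup>2 < e * (a' * d' - b' * c')" "c'\<^sup>2 < e * (a' * d' - b' * c')"
    unfolding small_off_diagonal_def by blast
  obtain k where k: "k \<noteq> 0" "a = k * a'" "b = k * b'" "c = k * c'" "d = k * d'"
    using real_moebius_eq_imp_proportional[OF *(1)[symmetric] *(2) det] by blast
  have scale: "e * (a * d - b * c) = k\<^sup>2 * (e * (a' * d' - b' * c'))"
    by (simp add: k algebra_simps power2_eq_square)
  have "k\<^sup>2 > 0" using k(1) by simp
  then show "b\<^sup>2 < e * (a * d - b * c) \<and> c\<^sup>2 < e * (a * d - b * c)"
    unfolding scale unfolding k(3,4) power_mult_distrib using *(3,4)
    by (blast intro: mult_strict_left_mono)
next
  assume "b\<^sup>2 < e * (a * d - b * c) \<and> c\<^sup>2 < e * (a * d - b * c)"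
  then show "real_moebius a b c d \<in> small_off_diagonal e"
    using det unfolding small_off_diagonal_def by blast
qed

text \<open>By the preceding lemma the preimage in coefficient space is cut out by strict polynomial
  inequalities.\<close>

lemma openin_small_off_diagonal: "openin moebius_topology (small_off_diagonal e)"
proof -
  have "{(a, b, c, d). a * d - b * c > 0 \<and> real_moebius a b c d \<in> small_off_diagonal e}
      = {(a, b, c, d). a * d - b * c > 0 \<and>
          b\<^sup>2 < e * (a * d - b * c) \<and> c\<^sup>2 < e * (a * d - b * c)}"
    using real_moebius_in_small_off_diagonal by auto
  moreover have "open {(a, b, c, d). a * d - b * c > 0 \<and>
      b\<^sup>2 < e * (a * d - b * c) \<and> c\<^sup>2 < e * (a * d - b * c)}"
    unfolding case_prod_unfold
    by (intro open_Collect_conj open_Collect_less continuous_intros)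
  ultimately show ?thesis
    unfolding openin_moebius_topology by (auto simp: small_off_diagonal_def moebius_group_def)
qed

section \<open>Words in the generators and their matrices\<close>

lemma generated_semigroup_base: "h \<in> X \<Longrightarrow> h \<in> generated_semigroup X"
  unfolding generated_semigroup_def by (intro CollectI exI[of _ "[h]"]) simp

lemma generated_semigroup_comp:
  assumes "s \<in> generated_semigroup X" "t \<in> generated_semigroup X"
  shows "s \<circ> t \<in> generated_semigroup X"
proof -
  obtain us vs where *: "s = foldr (\<circ>) us id" "us \<noteq> []" "set us \<subseteq> X"
    "t = foldr (\<circ>) vs id" "set vs \<subseteq> X"
    using assms unfolding generated_semigroup_def by blast
  have "foldr (\<circ>) us id \<circ> w = foldr (\<circ>) us w" for w :: "'a \<Rightarrow> 'a"
    by (induction us) (simp_all add: fun_eq_iff)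
  then have "s \<circ> t = foldr (\<circ>) (us @ vs) id" by (simp add: *)
  then show ?thesis
    using * unfolding generated_semigroup_def by (intro CollectI exI[of _ "us @ vs"]) auto
qed

lemma generated_semigroup_funpow:
  "s \<in> generated_semigroup X \<Longrightarrow> s ^^ Suc n \<in> generated_semigroup X"
  by (induction n) (auto intro: generated_semigroup_comp)

text \<open>Left multiplication by a generator acts on each column \<open>(x, y)\<close> separately,
  as \<open>(x + lam * y, y)\<close> or \<open>(x, y + mu * x)\<close>. Column invariants that hold
  for the identity matrix therefore hold for every word.\<close>

lemma word_columns:
  fixes lam mu :: real
  assumes P: "\<And>x y. P x y \<Longrightarrow> P (x + lam * y) y" "\<And>x y. P x y \<Longrightarrow> P x (y + mu * x)" "P 1 0"
    and Q: "\<And>x y. Q x y \<Longrightarrow> Q (x + lam * y) y" "\<And>x y. Q x y \<Longrightarrow> Q x (y + mu * x)" "Q 0 1"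
    and hs: "set hs \<subseteq> {real_moebius 1 lam 0 1, real_moebius 1 0 mu 1}"
  shows "\<exists>a b c d. foldr (\<circ>) hs id = real_moebius a b c d \<and> a * d - b * c = 1 \<and> P a c \<and> Q b d"
  using hs
proof (induction hs)
  case Nil
  then show ?case
    using P(3) Q(3) by (intro exI[of _ 1] exI[of _ 0]) (simp add: moebius_id)
next
  case (Cons h hs)
  then obtain a b c d where *: "foldr (\<circ>) hs id = real_moebius a b c d" "a * d - b * c = 1"
    "P a c" "Q b d"
    by (metis set_subset_Cons subset_trans)
  have det: "a * d - b * c > 0" using *(2) by simp
  from Cons.prems consider "h = real_moebius 1 lam 0 1" | "h = real_moebius 1 0 mu 1" by auto
  then show ?case
  proof cases
    case 1
    have "foldr (\<circ>) (h # hs) id = real_moebius (a + lam * c) (b + lam * d) c d"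
      using moebius_comp[OF _ det, of 1 1 lam 0] by (simp add: 1 *(1))
    moreover have "(a + lam * c) * d - (b + lam * d) * c = 1"
      using *(2) by (simp add: algebra_simps)
    ultimately show ?thesis using P(1)[OF *(3)] Q(1)[OF *(4)] by blast
  next
    case 2
    have "foldr (\<circ>) (h # hs) id = real_moebius a b (c + mu * a) (d + mu * b)"
      using moebius_comp[OF _ det, of 1 1 0 mu] by (simp add: 2 *(1) add.commute)
    moreover have "a * (d + mu * b) - b * (c + mu * a) = 1"
      using *(2) by (simp add: algebra_simps)
    ultimately show ?thesis using P(2)[OF *(3)] Q(2)[OF *(4)] by blast
  qed
qed

text \<open>Only the outermost letter needs a quantitative bound: if it is the translation, the
  upper right entry has modulus at least \<open>\<delta>\<close>, otherwise the lower left one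
  does.\<close>

lemma semidiscrete_inverse_freeI:
  fixes lam mu \<delta> :: real
  defines "S \<equiv> generated_semigroup {real_moebius 1 lam 0 1, real_moebius 1 0 mu 1}"
  assumes \<delta>: "\<delta> > 0"
    and P: "\<And>x y. P x y \<Longrightarrow> P (x + lam * y) y" "\<And>x y. P x y \<Longrightarrow> P x (y + mu * x)" "P 1 0"
      "\<And>x y. P x y \<Longrightarrow> \<bar>y + mu * x\<bar> \<ge> \<delta>"
    and Q: "\<And>x y. Q x y \<Longrightarrow> Q (x + lam * y) y" "\<And>x y. Q x y \<Longrightarrow> Q x (y + mu * x)" "Q 0 1"
      "\<And>x y. Q x y \<Longrightarrow> \<bar>x + lam * y\<bar> \<ge> \<delta>"
  shows "semidiscrete S \<and> inverse_free S"
proof -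
  let ?U = "small_off_diagonal (\<delta>\<^sup>2)"
  have "real_moebius 1 0 0 1 \<in> ?U" using \<delta> by (subst real_moebius_in_small_off_diagonal) simp_all
  then have id: "id \<in> ?U" by (simp add: moebius_id)
  \<comment> \<open>Disjointness of all of \<open>S\<close> from an open set around the identity
    yields both conclusions at once.\<close>
  have disj: "w \<notin> ?U" if wS: "w \<in> S" for w
  proof -
    obtain us where us: "w = foldr (\<circ>) us id" "us \<noteq> []"
      "set us \<subseteq> {real_moebius 1 lam 0 1, real_moebius 1 0 mu 1}"
      using wS unfolding S_def generated_semigroup_def by blast
    \<comment> \<open>The remaining word \<open>hs\<close> may be empty; the invariants then hold by
      \<open>P 1 0\<close> and \<open>Q 0 1\<close>.\<close>
    obtain h hs where "us = h # hs" using us(2) by (cases us) auto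
    then have w: "w = foldr (\<circ>) (h # hs) id"
      and hs: "set (h # hs) \<subseteq> {real_moebius 1 lam 0 1, real_moebius 1 0 mu 1}"
      using us by simp_all
    obtain a b c d where *: "foldr (\<circ>) hs id = real_moebius a b c d" "a * d - b * c = 1"
      "P a c" "Q b d"
    proof -
      have "\<exists>a b c d. foldr (\<circ>) hs id = real_moebius a b c d \<and> a * d - b * c = 1 \<and> P a c \<and> Q b d"
      proof (rule word_columns[where lam = lam and mu = mu])
        show "set hs \<subseteq> {real_moebius 1 lam 0 1, real_moebius 1 0 mu 1}" using hs by simp
      qed (fact P Q)+
      then show thesis using that by blast
    qed
    have det: "a * d - b * c > 0" using *(2) by simp
    have large: "\<not> x\<^sup>2 < \<delta>\<^sup>2" if "\<bar>x\<bar> \<ge> \<delta>" for x :: real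
      using that \<delta> by (metis abs_le_square_iff abs_of_pos not_less)
    from hs consider "h = real_moebius 1 lam 0 1" | "h = real_moebius 1 0 mu 1" by auto
    then show ?thesis
    proof cases
      case 1
      have w': "w = real_moebius (a + lam * c) (b + lam * d) c d"
        using moebius_comp[OF _ det, of 1 1 lam 0] by (simp add: w 1 *(1))
      have "(a + lam * c) * d - (b + lam * d) * c = 1"
        using *(2) by (simp add: algebra_simps)
      then show ?thesis
        using real_moebius_in_small_off_diagonal[of "a + lam * c" d "b + lam * d" c] large[OF Q(4)[OF *(4)]]
        by (simp add: w')
    next
      case 2
      have w': "w = real_moebius a b (c + mu * a) (d + mu * b)"
        using moebius_comp[OF _ det, of 1 1 0 mu] by (simp add: w 2 *(1) add.commute)
      have "a * (d + mu * b) - b * (c + mu * a) = 1"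
        using *(2) by (simp add: algebra_simps)
      then show ?thesis
        using real_moebius_in_small_off_diagonal[of a "d + mu * b" b "c + mu * a"] large[OF P(4)[OF *(3)]]
        by (simp add: w')
    qed
  qed
  have "semidiscrete S"
    using openin_small_off_diagonal id disj unfolding semidiscrete_def in_derived_set_of by blast
  moreover have "inverse_free S" using id disj unfolding inverse_free_def by blast
  ultimately show ?thesis by blast
qed

section \<open>Positive product: no cancellation\<close>

lemma add_mult_same_sign:
  fixes k u v :: real
  assumes "k * u * v \<ge> 0"
  shows "k * (u + k * v) * v \<ge> 0" "\<bar>u + k * v\<bar> = \<bar>u\<bar> + \<bar>k\<bar> * \<bar>v\<bar>"
proof -
  have same: "(k * v) * u \<ge> 0" using assms by (simp only: mult_ac)
  have "k * (u + k * v) * v = (k * v) * u + (k * v) * (k * v)" by (simp add: algebra_simps)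
  then show "k * (u + k * v) * v \<ge> 0" using same by simp
  have "\<bar>u + w\<bar> = \<bar>u\<bar> + \<bar>w\<bar>" if "w * u \<ge> 0" for w
    using that by (auto simp: zero_le_mult_iff)
  then show "\<bar>u + k * v\<bar> = \<bar>u\<bar> + \<bar>k\<bar> * \<bar>v\<bar>" using same by (metis abs_mult)
qed

lemma semidiscrete_inverse_free_pos:
  fixes lam mu :: real
  defines "S \<equiv> generated_semigroup {real_moebius 1 lam 0 1, real_moebius 1 0 mu 1}"
  assumes "lam * mu > 0"
  shows "semidiscrete S \<and> inverse_free S"
proof -
  have sgn: "lam > 0 \<and> mu > 0 \<or> lam < 0 \<and> mu < 0"
    using assms(2) by (simp add: zero_less_mult_iff)
  define R where "R = (\<lambda>x y. lam * x * y \<ge> 0)"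
  \<comment> \<open>Since \<open>lam\<close> and \<open>mu\<close> have the same sign, one sign
    relation between the entries of a column serves both generators.\<close>
  have R_mu: "R x y \<longleftrightarrow> mu * y * x \<ge> 0" for x y
    using sgn unfolding R_def by (auto simp: zero_le_mult_iff mult_le_0_iff)
  have R1: "R (x + lam * y) y \<and> \<bar>x + lam * y\<bar> = \<bar>x\<bar> + \<bar>lam\<bar> * \<bar>y\<bar>" if "R x y" for x y
    using that add_mult_same_sign[of lam x y] unfolding R_def by blast
  have R2: "R x (y + mu * x) \<and> \<bar>y + mu * x\<bar> = \<bar>y\<bar> + \<bar>mu\<bar> * \<bar>x\<bar>" if "R x y" for x y
    using that add_mult_same_sign[of mu y x] unfolding R_mu by blast
  \<comment> \<open>The last letter adds \<open>\<bar>mu\<bar> * \<bar>x\<bar>\<close> to the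
    modulus of the lower left entry or \<open>\<bar>lam\<bar> * \<bar>y\<bar>\<close> to that of the
    upper right one, and the factor \<open>\<bar>x\<bar>\<close> or \<open>\<bar>y\<bar>\<close> is
    at least 1.\<close>
  define \<delta> where "\<delta> = min \<bar>lam\<bar> \<bar>mu\<bar>"
  have \<delta>: "\<delta> > 0" using sgn by (auto simp: \<delta>_def)
  have P: "\<bar>y + mu * x\<bar> \<ge> \<delta>" if "R x y \<and> \<bar>x\<bar> \<ge> 1" for x y
    using R2[of x y] that mult_left_mono[of 1 "\<bar>x\<bar>" "\<bar>mu\<bar>"] by (simp add: \<delta>_def)
  have Q: "\<bar>x + lam * y\<bar> \<ge> \<delta>" if "R x y \<and> \<bar>y\<bar> \<ge> 1" for x y
    using R1[of x y] that mult_left_mono[of 1 "\<bar>y\<bar>" "\<bar>lam\<bar>"] by (simp add: \<delta>_def)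
  have ge: "p \<ge> 1 \<Longrightarrow> p + \<bar>u\<bar> * \<bar>v\<bar> \<ge> 1" for p u v :: real
    by (simp add: add_increasing2)
  show ?thesis
    unfolding S_def
  proof (rule semidiscrete_inverse_freeI[OF \<delta>, where P = "\<lambda>x y. R x y \<and> \<bar>x\<bar> \<ge> 1"
        and Q = "\<lambda>x y. R x y \<and> \<bar>y\<bar> \<ge> 1"])
    show "R (x + lam * y) y \<and> \<bar>x + lam * y\<bar> \<ge> 1" if "R x y \<and> \<bar>x\<bar> \<ge> 1" for x y
      using R1[of x y] that ge by auto
    show "R x (y + mu * x) \<and> \<bar>y + mu * x\<bar> \<ge> 1" if "R x y \<and> \<bar>y\<bar> \<ge> 1" for x y
      using R2[of x y] that ge by auto
    show "R x (y + mu * x) \<and> \<bar>x\<bar> \<ge> 1" if "R x y \<and> \<bar>x\<bar> \<ge> 1" for x y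
      using R2 that by blast
    show "R (x + lam * y) y \<and> \<bar>y\<bar> \<ge> 1" if "R x y \<and> \<bar>y\<bar> \<ge> 1" for x y
      using R1 that by blast
  qed (fact P Q | simp add: R_def)+
qed

section \<open>Product at most -4: ping-pong\<close>

text \<open>If \<open>k * v\<close> and \<open>u\<close> agree in sign, nothing cancels. If
  \<open>v\<close> dominates, \<open>k * v\<close> has modulus at least
  \<open>2 * \<bar>v\<bar>\<close>, so it decides the sign of the sum and leaves at least
  \<open>2 * \<bar>v\<bar> - \<bar>u\<bar>\<close>, which is at least
  \<open>\<bar>v\<bar> + e\<close>. The gap \<open>e\<close> survives either way.\<close>

lemma ping_pong_step:
  fixes k u v e :: real
  assumes "\<bar>k\<bar> \<ge> 2" and "k * u * v \<ge> 0 \<and> \<bar>u\<bar> \<ge> \<bar>v\<bar> + e \<or> \<bar>v\<bar> \<ge> \<bar>u\<bar> + e" and "e \<ge> 0"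
  shows "k * (u + k * v) * v \<ge> 0" "\<bar>u + k * v\<bar> \<ge> \<bar>v\<bar> + e"
proof -
  have kv: "\<bar>k * v\<bar> \<ge> 2 * \<bar>v\<bar>" using assms(1) by (simp add: abs_mult mult_right_mono)
  have eq: "k * (u + k * v) * v = (k * v) * u + (k * v) * (k * v)" by (simp add: algebra_simps)
  have "k * (u + k * v) * v \<ge> 0 \<and> \<bar>u + k * v\<bar> \<ge> \<bar>v\<bar> + e"
    using assms(2)
  proof
    assume *: "k * u * v \<ge> 0 \<and> \<bar>u\<bar> \<ge> \<bar>v\<bar> + e"
    then show ?thesis using add_mult_same_sign[of k u v] by (simp add: add_increasing2)
  next
    assume *: "\<bar>v\<bar> \<ge> \<bar>u\<bar> + e"
    have "\<bar>u\<bar> \<le> \<bar>k * v\<bar>" using * kv assms(3) by linarith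
    then have "\<bar>k * v * u\<bar> \<le> k * v * (k * v)"
      by (metis abs_ge_zero abs_mult abs_mult_self_eq mult_left_mono)
    then have "k * (u + k * v) * v \<ge> 0" unfolding eq by linarith
    moreover have "\<bar>u + k * v\<bar> \<ge> \<bar>v\<bar> + e" using * kv by linarith
    ultimately show ?thesis by blast
  qed
  then show "k * (u + k * v) * v \<ge> 0" "\<bar>u + k * v\<bar> \<ge> \<bar>v\<bar> + e" by blast+
qed

lemma semidiscrete_inverse_free_le:
  fixes lam mu :: real
  defines "S \<equiv> generated_semigroup {real_moebius 1 lam 0 1, real_moebius 1 0 mu 1}"
  assumes le: "lam * mu \<le> -4"
  shows "semidiscrete S \<and> inverse_free S"
proof -
  \<comment> \<open>In the coordinates \<open>(u, v) = (x, \<lambda>y/2)\<close> the generators act as \<open>u + 2v\<close> and \<open>v + \<kappa>u\<close>.\<close>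
  define \<kappa> where "\<kappa> = lam * mu / 2"
  \<comment> \<open>The two alternatives are the ping-pong regions: \<open>F\<close> sends both into
    the first, and \<open>G\<close> sends both into the second. The sign in the second is reversed
    because \<open>\<kappa>\<close> is negative.\<close>
  define K where "K = (\<lambda>e u v. u * v \<ge> 0 \<and> \<bar>u\<bar> \<ge> \<bar>v\<bar> + e \<or> u * v \<le> 0 \<and> \<bar>v\<bar> \<ge> \<bar>u\<bar> + (e::real))"
  have \<kappa>: "\<kappa> \<le> -2" using le by (simp add: \<kappa>_def)
  have lam: "lam \<noteq> 0" using le by auto
  have F: "K e (u + 2 * v) v \<and> \<bar>u + 2 * v\<bar> \<ge> e" if "K e u v" "e \<ge> 0" for e u v
    using ping_pong_step[of 2 u v e] that unfolding K_def by (auto simp: zero_le_mult_iff)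
  have G: "K e u (v + \<kappa> * u) \<and> \<bar>v + \<kappa> * u\<bar> \<ge> e" if "K e u v" "e \<ge> 0" for e u v
  proof -
    have "\<kappa> * v * u \<ge> 0" if "u * v \<le> 0"
      using mult_nonpos_nonpos[of \<kappa> "u * v"] that \<kappa> by (simp add: algebra_simps)
    then have *: "\<kappa> * (v + \<kappa> * u) * u \<ge> 0" "\<bar>v + \<kappa> * u\<bar> \<ge> \<bar>u\<bar> + e"
      using ping_pong_step[of \<kappa> v u e] that \<kappa> unfolding K_def by auto
    have "\<kappa> * (u * (v + \<kappa> * u)) \<ge> 0" using *(1) by (simp only: mult_ac)
    then have "u * (v + \<kappa> * u) \<le> 0" using \<kappa> by (subst (asm) zero_le_mult_iff) linarith
    then show ?thesis using *(2) unfolding K_def by auto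
  qed
  define P where "P = (\<lambda>e x y. K e x (lam / 2 * y))"
  have P1: "P e (x + lam * y) y \<and> \<bar>x + lam * y\<bar> \<ge> e" if "P e x y" "e \<ge> 0" for e x y
    using F[of e x "lam / 2 * y"] that by (simp add: P_def)
  have P2: "P e x (y + mu * x) \<and> \<bar>lam / 2 * (y + mu * x)\<bar> \<ge> e" if "P e x y" "e \<ge> 0" for e x y
  proof -
    have "lam / 2 * (y + mu * x) = lam / 2 * y + \<kappa> * x" by (simp add: \<kappa>_def algebra_simps)
    then show ?thesis using G[of e x "lam / 2 * y"] that unfolding P_def by metis
  qed
  \<comment> \<open>In the coordinates \<open>(u, v)\<close> the columns of the identity are
    \<open>(1, 0)\<close> and \<open>(0, lam / 2)\<close>, so their gaps are 1 and
    \<open>\<bar>lam\<bar> / 2\<close>. Converting a bound 1 on \<open>v\<close> back to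
    \<open>y\<close> turns it into \<open>2 / \<bar>lam\<bar>\<close>.\<close>
  define \<delta> where "\<delta> = min (\<bar>lam\<bar> / 2) (2 / \<bar>lam\<bar>)"
  have \<delta>: "\<delta> > 0" using lam by (auto simp: \<delta>_def)
  have c: "\<bar>y + mu * x\<bar> \<ge> \<delta>" if "P 1 x y" for x y
  proof -
    have "\<bar>lam\<bar> / 2 * \<bar>y + mu * x\<bar> \<ge> 1" using P2[OF that] by (simp add: abs_mult)
    then have "\<bar>y + mu * x\<bar> \<ge> 2 / \<bar>lam\<bar>" using lam by (simp add: field_simps)
    then show ?thesis by (simp add: \<delta>_def)
  qed
  have b: "\<bar>x + lam * y\<bar> \<ge> \<delta>" if "P (\<bar>lam\<bar> / 2) x y" for x y
    using P1[OF that] unfolding \<delta>_def by (intro min.coboundedI1) simp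
  show ?thesis
    unfolding S_def
  proof (rule semidiscrete_inverse_freeI[OF \<delta>, where P = "P 1" and Q = "P (\<bar>lam\<bar> / 2)"])
    show "P 1 1 0" "P (\<bar>lam\<bar> / 2) 0 1" by (simp_all add: P_def K_def)
    show "P 1 (x + lam * y) y" "P 1 x (y + mu * x)" if "P 1 x y" for x y
      using P1[OF that] P2[OF that] by simp_all
    show "P (\<bar>lam\<bar> / 2) (x + lam * y) y" "P (\<bar>lam\<bar> / 2) x (y + mu * x)"
      if "P (\<bar>lam\<bar> / 2) x y" for x y
      using P1[OF that] P2[OF that] by simp_all
  qed (fact c b)+
qed

section \<open>Elliptic transformations and their powers\<close>

text \<open>Cayley--Hamilton: \<open>M\<^sup>n\<^sup>+\<^sup>2 = (tr M) M\<^sup>n\<^sup>+\<^sup>1 - M\<^sup>n\<close>, and \<open>s\<close> satisfies the same recursion.\<close>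

lemma elliptic_funpow:
  fixes A B C D \<theta> :: real
  defines "s \<equiv> \<lambda>n. sin (real n * \<theta>) / sin \<theta>"
  assumes det: "A * D - B * C = 1" and tr: "A + D = 2 * cos \<theta>" and sin: "sin \<theta> \<noteq> 0"
  shows "real_moebius A B C D ^^ Suc n =
    real_moebius (s (Suc n) * A - s n) (s (Suc n) * B) (s (Suc n) * C) (s (Suc n) * D - s n) \<and>
    (s (Suc n) * A - s n) * (s (Suc n) * D - s n) - (s (Suc n) * B) * (s (Suc n) * C) = 1"
    (is "?eq n \<and> ?det n")
proof (induction n)
  case 0
  then show ?case using det sin by (simp add: s_def)
next
  case (Suc n)
  \<comment> \<open>The addition formulas give the Chebyshev recursion, with
    \<open>2 * cos \<theta>\<close> equal to the trace.\<close>
  have rec: "s (Suc (Suc n)) = (A + D) * s (Suc n) - s n"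
  proof -
    have "sin (real (Suc (Suc n)) * \<theta>) + sin (real n * \<theta>) = 2 * cos \<theta> * sin (real (Suc n) * \<theta>)"
      using sin_add[of "real (Suc n) * \<theta>" \<theta>] sin_diff[of "real (Suc n) * \<theta>" \<theta>]
      by (simp add: algebra_simps)
    then have "sin (real (Suc (Suc n)) * \<theta>)
        = (A + D) * sin (real (Suc n) * \<theta>) - sin (real n * \<theta>)"
      by (simp add: tr)
    then show ?thesis using sin by (simp only: s_def) (simp add: field_simps)
  qed
  define p q where "p = s (Suc n)" and "q = s n"
  have BC: "B * C = A * D - 1" using det by simp
  \<comment> \<open>\<open>moebius_comp\<close> asks for a positive determinant, which is why the
    determinant is carried through the induction.\<close>
  have det': "(p * A - q) * (p * D - q) - (p * B) * (p * C) > 0"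
    using Suc by (simp add: p_def q_def)
  have prod: "A * (p * A - q) + B * (p * C) = ((A + D) * p - q) * A - p"
    "A * (p * B) + B * (p * D - q) = ((A + D) * p - q) * B"
    "C * (p * A - q) + D * (p * C) = ((A + D) * p - q) * C"
    "C * (p * B) + D * (p * D - q) = ((A + D) * p - q) * D - p"
    using BC by algebra+
  have "real_moebius A B C D ^^ Suc (Suc n) =
      real_moebius A B C D \<circ> real_moebius (p * A - q) (p * B) (p * C) (p * D - q)"
    unfolding p_def q_def using Suc by (simp only: funpow.simps)
  also have "\<dots> = real_moebius (((A + D) * p - q) * A - p) (((A + D) * p - q) * B)
      (((A + D) * p - q) * C) (((A + D) * p - q) * D - p)"
    using moebius_comp[OF _ det', of A D B C] det by (simp add: prod)
  finally have 1: "?eq (Suc n)" unfolding rec p_def q_def .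
  have "(p * A - q) * (p * D - q) - (p * B) * (p * C) = 1"
    using Suc by (simp add: p_def q_def)
  then have "(((A + D) * p - q) * A - p) * (((A + D) * p - q) * D - p)
      - (((A + D) * p - q) * B) * (((A + D) * p - q) * C) = 1"
    using BC by algebra
  then have 2: "?det (Suc n)" unfolding rec p_def q_def .
  show ?case using 1 2 by blast
qed

text \<open>Dirichlet approximation of \<open>\<theta> / (2 * pi)\<close> with denominator at most
  \<open>N\<close> puts a positive multiple of \<open>\<theta>\<close> within
  \<open>2 * pi / N\<close> of a multiple of \<open>2 * pi\<close>.\<close>

lemma ex_multiple_near_full_turn:
  fixes \<theta> \<epsilon> :: real
  assumes "\<epsilon> > 0"
  shows "\<exists>n. \<bar>sin (real (Suc n) * \<theta>)\<bar> < \<epsilon> \<and> \<bar>cos (real (Suc n) * \<theta>) - 1\<bar> < \<epsilon>"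
proof -
  obtain N :: nat where N: "real N > 2 * pi / \<epsilon>" using reals_Archimedean2 by blast
  have N0: "N > 0" using N assms pi_gt_zero
    by (metis divide_pos_pos gr0I mult_pos_pos of_nat_0 not_less_iff_gr_or_eq zero_less_numeral)
  obtain h k where hk: "0 < k" "k \<le> int N" "\<bar>of_int k * (\<theta> / (2 * pi)) - of_int h\<bar> < 1 / N"
    using Dirichlet_approx[OF N0, of "\<theta> / (2 * pi)"] by blast
  obtain n where n: "k = int (Suc n)" using hk(1) by (metis gr0_implies_Suc zero_less_imp_eq_int)
  define x where "x = real (Suc n) * \<theta> - 2 * pi * of_int h"
  have "x = 2 * pi * (of_int k * (\<theta> / (2 * pi)) - of_int h)"
    by (simp add: x_def n field_simps)
  then have "\<bar>x\<bar> = 2 * pi * \<bar>of_int k * (\<theta> / (2 * pi)) - of_int h\<bar>" by (simp add: abs_mult)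
  also have "\<dots> < 2 * pi * (1 / N)" using hk(3) by (intro mult_strict_left_mono) auto
  also have "\<dots> < \<epsilon>" using N N0 assms by (simp add: field_simps)
  finally have x: "\<bar>x\<bar> < \<epsilon>" .
  have eq: "real (Suc n) * \<theta> = x + 2 * pi * of_int h" by (simp add: x_def)
  have "sin (real (Suc n) * \<theta>) = sin x" "cos (real (Suc n) * \<theta>) = cos x"
    unfolding eq sin_add cos_add by simp_all
  moreover have "\<bar>sin x\<bar> < \<epsilon>" using abs_sin_x_le_abs_x[of x] x by linarith
  moreover have "\<bar>cos x - 1\<bar> < \<epsilon>"
  proof -
    \<comment> \<open>Half-angle bound: \<open>1 - cos x\<close> is twice the square of
      \<open>sin (x / 2)\<close>, hence at most \<open>2 * \<bar>sin (x / 2)\<bar>\<close>, which is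
      at most \<open>\<bar>x\<bar>\<close>.\<close>
    have "(sin (x / 2))\<^sup>2 \<le> \<bar>sin (x / 2)\<bar>"
      using mult_left_le[of "\<bar>sin (x / 2)\<bar>" "\<bar>sin (x / 2)\<bar>"] by (simp add: power2_eq_square)
    also have "\<dots> \<le> \<bar>x / 2\<bar>" by (rule abs_sin_x_le_abs_x)
    finally have "1 - cos x \<le> \<bar>x\<bar>" using cos_double_sin[of "x / 2"] by simp
    then show ?thesis using x cos_le_one[of x] by linarith
  qed
  ultimately show ?thesis by metis
qed

text \<open>The coefficients of the m-th power are a continuous function of
  \<open>(sin (m * \<theta>), cos (m * \<theta>))\<close>, and this point comes arbitrarily close to
  \<open>(0, 1)\<close>, where they are those of the identity.\<close>

lemma elliptic_powers_accumulate:
  fixes A B C D :: real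
  assumes det: "A * D - B * C = 1" and tr: "\<bar>A + D\<bar> < 2"
    and U: "openin moebius_topology U" "id \<in> U"
  shows "\<exists>n. real_moebius A B C D ^^ Suc n \<in> U"
proof -
  define \<theta> where "\<theta> = arccos ((A + D) / 2)"
  have cos: "A + D = 2 * cos \<theta>" using tr by (simp add: \<theta>_def cos_arccos_abs)
  have sin: "sin \<theta> \<noteq> 0"
    using tr by (simp add: \<theta>_def sin_arccos_nonzero)
  define V where "V = {(a, b, c, d). a * d - b * c > 0 \<and> real_moebius a b c d \<in> U}"
  \<comment> \<open>For the sine and cosine of \<open>m * \<theta>\<close>, \<open>p\<close> and
    \<open>q\<close> are the factors of \<open>elliptic_funpow\<close>; the subtraction formula
    expresses \<open>sin ((m - 1) * \<theta>)\<close> in \<open>q\<close>. At \<open>(0, 1)\<close>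
    one has \<open>p = 0\<close> and \<open>q = -1\<close>.\<close>
  define \<phi> where "\<phi> = (\<lambda>(x::real, y::real). let p = x / sin \<theta>; q = (x * cos \<theta> - y * sin \<theta>) / sin \<theta>
    in (p * A - q, p * B, p * C, p * D - q))"
  have V: "open V" using U(1) unfolding V_def openin_moebius_topology by blast
  have "continuous_on UNIV \<phi>"
    unfolding \<phi>_def case_prod_unfold Let_def using sin by (intro continuous_intros) auto
  then have "open (\<phi> -` V)" using V by (rule open_vimage[rotated])
  moreover have "(0, 1) \<in> \<phi> -` V"
    using sin U(2) by (simp add: \<phi>_def V_def moebius_id)
  ultimately obtain \<epsilon> where \<epsilon>: "\<epsilon> > 0" "\<And>z. dist z (0, 1) < \<epsilon> \<Longrightarrow> \<phi> z \<in> V"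
    unfolding open_dist by blast
  obtain n where n: "\<bar>sin (real (Suc n) * \<theta>)\<bar> < \<epsilon> / 2" "\<bar>cos (real (Suc n) * \<theta>) - 1\<bar> < \<epsilon> / 2"
    using ex_multiple_near_full_turn[of "\<epsilon> / 2" \<theta>] \<epsilon>(1) by auto
  define z where "z = (sin (real (Suc n) * \<theta>), cos (real (Suc n) * \<theta>))"
  have "dist z (0, 1) \<le> \<bar>sin (real (Suc n) * \<theta>)\<bar> + \<bar>cos (real (Suc n) * \<theta>) - 1\<bar>"
    unfolding z_def dist_Pair_Pair dist_real_def diff_zero power2_abs
    by (rule sqrt_sum_squares_le_sum_abs)
  then have "\<phi> z \<in> V" using n by (intro \<epsilon>(2)) linarith
  moreover have "sin (real n * \<theta>) = sin (real (Suc n) * \<theta>) * cos \<theta> - cos (real (Suc n) * \<theta>) * sin \<theta>"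
    using sin_diff[of "real (Suc n) * \<theta>" \<theta>] by (simp add: algebra_simps)
  ultimately show ?thesis
    using elliptic_funpow[OF det cos sin, of n]
    by (intro exI[of _ n]) (simp add: \<phi>_def z_def V_def Let_def)
qed

section \<open>The equivalence, by ranges of \<open>lam * mu\<close>\<close>

theorem corollary1p7:
  fixes lam mu :: real and f g :: "complex option \<Rightarrow> complex option"
  assumes "f = real_moebius 1 lam 0 1" and "g = real_moebius 1 0 mu 1"
  shows "semidiscrete (generated_semigroup {f, g}) \<and> inverse_free (generated_semigroup {f, g})
    \<longleftrightarrow> lam * mu \<notin> {-4<..0}"
proof
  assume "lam * mu \<notin> {-4<..0}"
  then consider "lam * mu > 0" | "lam * mu \<le> -4" by fastforce
  then show "semidiscrete (generated_semigroup {f, g}) \<and> inverse_free (generated_semigroup {f, g})"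
    unfolding assms
    by cases (simp_all add: semidiscrete_inverse_free_pos semidiscrete_inverse_free_le)
next
  let ?S = "generated_semigroup {f, g}"
  assume S: "semidiscrete ?S \<and> inverse_free ?S"
  then have id: "id \<notin> ?S" by (simp add: inverse_free_def)
  show "lam * mu \<notin> {-4<..0}"
  proof
    assume range: "lam * mu \<in> {-4<..0}"
    \<comment> \<open>Inverse freeness already excludes a vanishing product, since then a generator
      would be the identity.\<close>
    have "f \<noteq> id" "g \<noteq> id" using id generated_semigroup_base[of _ "{f, g}"] by auto
    then have "lam \<noteq> 0" "mu \<noteq> 0" unfolding assms by (auto simp: moebius_id)
    then have "lam * mu < 0" using range by (simp add: less_le)
    then have tr: "\<bar>(1 + lam * mu) + 1\<bar> < 2" using range by auto
    have fg: "f \<circ> g = real_moebius (1 + lam * mu) lam mu 1"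
      unfolding assms by (subst moebius_comp) simp_all
    have "id \<in> moebius_topology derived_set_of ?S"
      unfolding in_derived_set_of
    proof (intro conjI allI impI)
      have "real_moebius 1 0 0 1 \<in> moebius_group"
        unfolding moebius_group_def by (intro CollectI exI[of _ 1] exI[of _ 0]) simp
      then show "id \<in> topspace moebius_topology"
        by (simp add: topspace_moebius_topology moebius_id)
      fix T assume T: "id \<in> T \<and> openin moebius_topology T"
      obtain n where n: "(f \<circ> g) ^^ Suc n \<in> T"
        using elliptic_powers_accumulate[of "1 + lam * mu" 1 lam mu T] tr T unfolding fg
        by (auto simp del: funpow.simps)
      have "(f \<circ> g) ^^ Suc n \<in> ?S"
        by (intro generated_semigroup_funpow generated_semigroup_comp generated_semigroup_base) auto
      \<comment> \<open>A rotation of finite order needs no separate case: the power lies in the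
        semigroup, so inverse freeness makes it differ from the identity, as an accumulation point
        requires.\<close>
      then show "\<exists>y. y \<noteq> id \<and> y \<in> ?S \<and> y \<in> T" using n id by metis
    qed
    then show False using S by (simp add: semidiscrete_def)
  qed
qed

end
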